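(* Let $\mathbb{F}$ be an infinite field of characteristic $p\geq 0$. The following set is an $\mathbb{F}$-basis of the space of all polynomial identities for $\mathsf{A}_1^{(-,1)}$ of multidegree $(2,1,1)$ (in the variables $x_1,x_2,x_3$): (a) $x_1\,\mathrm{St}_3(x_1,x_2,x_3)$, $\mathrm{St}_3(x_1,x_2,x_3)\,x_1$, $\Phi_{211}$, in case $p\neq 2$; (b) $x_1\,\mathrm{St}_3(x_1,x_2,x_3)$, $\mathrm{St}_3(x_1,x_2,x_3)\,x_1$, $\Psi_{211}$, $[[x_1,x_2],[x_1,x_3]]$, in case $p=2$.
   Context: $\mathbb{F}\langle X\rangle$ is the free unital associative $\mathbb{F}$-algebra on $X=\{x_1,x_2,\dots\}$, and $[a,b]=ab-ba$. The Weyl algebra $\mathsf{A}_1$ is the unital associative $\mathbb{F}$-algebra generated by $x,y$ with defining relation $yx=xy+1$, and $\mathsf{A}_1^{(-,1)}\subset\mathsf{A}_1$ is the $\mathbb{F}$-linear span of all elements $ay$ with $a\in\mathbb{F}[x]$. An element $f(x_1,\dots,x_m)\in\mathbb{F}\langle X\rangle$ is a polynomial identity for a subspace $\mathcal{V}$ of an associative algebra $\mathcal{A}$ if $f(a_1,\dots,a_m)=0$ in $\mathcal{A}$ for all $a_1,\dots,a_m\in\mathcal{V}$. The multidegree of a monomial $w$ in $x_1,\dots,x_m$ is $(\deg_{x_1}w,\dots,\deg_{x_m}w)$; an element has a given multidegree if it is a linear combination of monomials of that multidegree. The standard polynomial is $\mathrm{St}_3(z_1,z_2,z_3)=\sum_{\sigma\in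 S_3}(-1)^{\sigma}z_{\sigma(1)}z_{\sigma(2)}z_{\sigma(3)}$. Let $\Phi_{22}(x_1,x_2)= x_1^2 x_2^2 - 3 x_1 x_2 x_1 x_2 + 2 x_1 x_2^2 x_1 + 2 x_2 x_1^2 x_2 - 3 x_2 x_1 x_2 x_1 + x_2^2 x_1^2$. Then $\Phi_{211}$ is the partial linearization of $\Phi_{22}$ in $x_2$, i.e. the component of multidegree $(2,1,1)$ in $x_1,x_2,x_3$ of $\Phi_{22}(x_1,x_2+x_3)$. Finally $\Psi_{211}=x_1[x_1,x_2]x_3+x_3[x_1,x_2]x_1$. *)

theory Defs
  imports
    "HOL-Library.Poly_Mapping"
    "HOL-Combinatorics.Permutations"
    "HOL-Computational_Algebra.Polynomial"
begin

section \<open>Free associative algebras\<close>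

text \<open>The free monoid, written additively with concatenation as \<open>+\<close>, so that the convolution product of
  \<^theory>\<open>HOL-Library.Poly_Mapping\<close> is the product of the monoid algebra.\<close>

datatype 'v word = Word (letters: "'v list")

instantiation word :: (type) monoid_add
begin

definition zero_word :: "'a word" where
  "0 = Word []"

definition plus_word :: "'a word \<Rightarrow> 'a word \<Rightarrow> 'a word" where
  "u + v = Word (letters u @ letters v)"

instance
  by standard (auto simp: zero_word_def plus_word_def)

end

type_synonym ('v, 'a) falg = "'v word \<Rightarrow>\<^sub>0 'a"

definition var :: "'v \<Rightarrow> ('v, 'a::field) falg" where
  "var v = Poly_Mapping.single (Word [v]) 1"

definition falg_scale :: "'a::field \<Rightarrow> ('v, 'a) falg \<Rightarrow> ('v, 'a) falg" where
  "falg_scale c f = Poly_Mapping.map ((*) c) f"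

lemma lookup_falg_scale [simp]: "Poly_Mapping.lookup (falg_scale c f) w = c * Poly_Mapping.lookup f w"
  by (simp add: falg_scale_def map.rep_eq when_def)

lemma falg_scale_conv_mult: "falg_scale c f = Poly_Mapping.single 0 c * f"
  unfolding falg_scale_def by (rule mult_map_scale_conv_mult)

lemma falg_scale_mult_left: "falg_scale c f * g = falg_scale c (f * g)"
  by (simp add: falg_scale_conv_mult mult.assoc)

lemma mult_single_zero_comm:
  fixes f :: "('v, 'a::field) falg"
  shows "f * Poly_Mapping.single 0 c = Poly_Mapping.single 0 c * f"
proof (induction f rule: update_induct)
  case const
  show ?case by simp
next
  case (update f k v)
  have "Poly_Mapping.update k v f = f + Poly_Mapping.single k v"
    using update.hyps(1)
    by (intro poly_mapping_eqI) (auto simp: lookup_update lookup_add lookup_single when_def in_keys_iff)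
  then show ?case
    using update.IH by (simp add: distrib_left distrib_right mult_single mult.commute)
qed

lemma falg_scale_mult_right: "f * falg_scale c g = falg_scale c (f * g)"
  by (metis falg_scale_conv_mult mult.assoc mult_single_zero_comm)

section \<open>Algebras over a field and their polynomial identities\<close>

text \<open>We use the sort \<open>{ring, monoid_mult}\<close> rather than \<open>ring_1\<close>, since the latter includes \<open>0 \<noteq> 1\<close>.\<close>

locale assoc_algebra = vector_space scale
  for scale :: "'a::field \<Rightarrow> 'b::{ring, monoid_mult} \<Rightarrow> 'b" +
  assumes scale_mult_left: "scale c u * v = scale c (u * v)"
    and scale_mult_right: "u * scale c v = scale c (u * v)"
begin

definition eval :: "('v \<Rightarrow> 'b) \<Rightarrow> ('v, 'a) falg \<Rightarrow> 'b" where
  "eval a f = (\<Sum>w\<in>Poly_Mapping.keys f. scale (Poly_Mapping.lookup f w) (prod_list (map a (letters w))))"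

text \<open>Here all variables of the alphabet are assigned values, not only those occurring in \<open>f\<close>;
  this makes no difference as \<open>V\<close>, being a subspace, is nonempty.\<close>

definition polynomial_identity :: "'b set \<Rightarrow> ('v, 'a) falg \<Rightarrow> bool" where
  "polynomial_identity V f \<longleftrightarrow> (\<forall>a. (\<forall>v. a v \<in> V) \<longrightarrow> eval a f = 0)"

end

global_interpretation falg: assoc_algebra "falg_scale :: 'a::field \<Rightarrow> ('v, 'a) falg \<Rightarrow> ('v, 'a) falg"
proof
  show "falg_scale c (f + g) = falg_scale c f + falg_scale c g" for c :: 'a and f g :: "('v, 'a) falg"
    by (rule poly_mapping_eqI) (simp add: lookup_add algebra_simps)
  show "falg_scale (c + d) f = falg_scale c f + falg_scale d f" for c d :: 'a and f :: "('v, 'a) falg"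
    by (rule poly_mapping_eqI) (simp add: lookup_add algebra_simps)
  show "falg_scale c (falg_scale d f) = falg_scale (c * d) f" for c d :: 'a and f :: "('v, 'a) falg"
    by (rule poly_mapping_eqI) simp
  show "falg_scale 1 f = f" for f :: "('v, 'a) falg"
    by (rule poly_mapping_eqI) simp
qed (simp_all add: falg_scale_mult_left falg_scale_mult_right)

section \<open>The Weyl algebra\<close>

datatype weyl_gen = GX | GY

text \<open>The two-sided ideal generated by \<open>yx - xy - 1\<close>.\<close>

inductive_set weyl_ideal :: "(weyl_gen, 'a::field) falg set" where
  zero: "0 \<in> weyl_ideal"
| relation: "f * (var GY * var GX - var GX * var GY - 1) * g \<in> weyl_ideal"
| add: "f \<in> weyl_ideal \<Longrightarrow> g \<in> weyl_ideal \<Longrightarrow> f + g \<in> weyl_ideal"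

lemma weyl_ideal_mult_left: "f \<in> weyl_ideal \<Longrightarrow> h * f \<in> weyl_ideal"
proof (induction rule: weyl_ideal.induct)
  case (relation f g)
  then show ?case using weyl_ideal.relation[of "h * f" g] by (simp add: mult.assoc)
qed (auto simp: distrib_left intro: weyl_ideal.intros)

lemma weyl_ideal_mult_right: "f \<in> weyl_ideal \<Longrightarrow> f * h \<in> weyl_ideal"
proof (induction rule: weyl_ideal.induct)
  case (relation f g)
  then show ?case using weyl_ideal.relation[of f "g * h"] by (simp add: mult.assoc)
qed (auto simp: distrib_right intro: weyl_ideal.intros)

lemma weyl_ideal_uminus: "f \<in> weyl_ideal \<Longrightarrow> - f \<in> weyl_ideal"
  using weyl_ideal_mult_left[of f "-1"] by simp

lemma weyl_ideal_diff: "f \<in> weyl_ideal \<Longrightarrow> g \<in> weyl_ideal \<Longrightarrow> f - g \<in> weyl_ideal"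
  using weyl_ideal.add[of f "- g"] weyl_ideal_uminus[of g] by simp

definition weyl_rel :: "(weyl_gen, 'a::field) falg \<Rightarrow> (weyl_gen, 'a) falg \<Rightarrow> bool" where
  "weyl_rel f g \<longleftrightarrow> f - g \<in> weyl_ideal"

lemma equivp_weyl_rel: "equivp weyl_rel"
proof (rule equivpI)
  show "reflp weyl_rel"
    by (auto simp: reflp_def weyl_rel_def intro: weyl_ideal.zero)
  show "symp weyl_rel"
    unfolding symp_def weyl_rel_def by (metis minus_diff_eq weyl_ideal_uminus)
  show "transp weyl_rel"
    unfolding transp_def weyl_rel_def using weyl_ideal.add by (metis diff_add_cancel add_diff_eq)
qed

quotient_type (overloaded) 'a weyl = "(weyl_gen, 'a::field) falg" / weyl_rel
  by (rule equivp_weyl_rel)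

instantiation weyl :: (field) ring
begin

lift_definition zero_weyl :: "'a weyl" is 0 .

lift_definition plus_weyl :: "'a weyl \<Rightarrow> 'a weyl \<Rightarrow> 'a weyl" is "(+)"
  unfolding weyl_rel_def by (simp only: add_diff_add weyl_ideal.add)

lift_definition uminus_weyl :: "'a weyl \<Rightarrow> 'a weyl" is uminus
proof -
  fix f f' :: "(weyl_gen, 'a) falg"
  assume "weyl_rel f f'"
  then have "- (f - f') \<in> weyl_ideal"
    unfolding weyl_rel_def by (rule weyl_ideal_uminus)
  then show "weyl_rel (- f) (- f')"
    by (simp add: weyl_rel_def)
qed

lift_definition minus_weyl :: "'a weyl \<Rightarrow> 'a weyl \<Rightarrow> 'a weyl" is "(-)"
proof -
  fix f f' g g' :: "(weyl_gen, 'a) falg"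
  assume "weyl_rel f f'" "weyl_rel g g'"
  then have "(f - f') - (g - g') \<in> weyl_ideal"
    unfolding weyl_rel_def by (rule weyl_ideal_diff)
  then show "weyl_rel (f - g) (f' - g')"
    by (simp add: weyl_rel_def algebra_simps)
qed

lift_definition times_weyl :: "'a weyl \<Rightarrow> 'a weyl \<Rightarrow> 'a weyl" is "(*)"
proof -
  fix f f' g g' :: "(weyl_gen, 'a) falg"
  assume "weyl_rel f f'" "weyl_rel g g'"
  then have "(f - f') * g + f' * (g - g') \<in> weyl_ideal"
    unfolding weyl_rel_def
    by (intro weyl_ideal.add weyl_ideal_mult_left weyl_ideal_mult_right)
  then show "weyl_rel (f * g) (f' * g')"
    by (simp add: weyl_rel_def algebra_simps)
qed

instance
  by (intro_classes; transfer; simp add: weyl_rel_def weyl_ideal.zero algebra_simps)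

end

instantiation weyl :: (field) monoid_mult
begin

lift_definition one_weyl :: "'a weyl" is 1 .

instance
  by (intro_classes; transfer; simp add: weyl_rel_def weyl_ideal.zero algebra_simps)

end

lift_definition weyl_scale :: "'a::field \<Rightarrow> 'a weyl \<Rightarrow> 'a weyl" is falg_scale
  unfolding weyl_rel_def
  by (metis falg_scale_conv_mult right_diff_distrib weyl_ideal_mult_left)

lift_definition weyl_x :: "'a::field weyl" is "var GX" .

lift_definition weyl_y :: "'a::field weyl" is "var GY" .

global_interpretation weyl: assoc_algebra "weyl_scale :: 'a::field \<Rightarrow> 'a weyl \<Rightarrow> 'a weyl"
  by (standard; transfer)
    (simp_all add: weyl_rel_def weyl_ideal.zero falg.scale_right_distrib falg.scale_left_distrib
      falg_scale_mult_left falg_scale_mult_right)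

definition weyl_of_poly :: "'a::field poly \<Rightarrow> 'a weyl" where
  "weyl_of_poly p = (\<Sum>i\<le>degree p. weyl_scale (coeff p i) (weyl_x ^ i))"

text \<open>\<open>A\<^sub>1\<^sup>(\<^sup>-\<^sup>,\<^sup>1\<^sup>)\<close>, the span of all \<open>a y\<close> with \<open>a\<close> a polynomial in \<open>x\<close> alone.\<close>

definition weyl_minus_1 :: "'a::field weyl set" where
  "weyl_minus_1 = weyl.span {weyl_of_poly p * weyl_y |p. True}"

section \<open>Multidegrees\<close>

text \<open>The variables \<open>x\<^sub>1, x\<^sub>2, \<dots>\<close> are numbered from 0: the letter \<open>i\<close> stands for \<open>x\<^sub>i\<^sub>+\<^sub>1\<close>, so that
  the \<open>i\<close>-th entry of the list \<open>ds\<close> is the degree in the letter \<open>i\<close>.\<close>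

definition word_has_multidegree :: "nat list \<Rightarrow> nat word \<Rightarrow> bool" where
  "word_has_multidegree ds w \<longleftrightarrow>
     set (letters w) \<subseteq> {..<length ds} \<and> (\<forall>i<length ds. count_list (letters w) i = ds ! i)"

definition has_multidegree :: "nat list \<Rightarrow> (nat, 'a::field) falg \<Rightarrow> bool" where
  "has_multidegree ds f \<longleftrightarrow> (\<forall>w\<in>Poly_Mapping.keys f. word_has_multidegree ds w)"

definition multidegree_component :: "nat list \<Rightarrow> (nat, 'a::field) falg \<Rightarrow> (nat, 'a) falg" where
  "multidegree_component ds f =
     (\<Sum>w\<in>{w \<in> Poly_Mapping.keys f. word_has_multidegree ds w}. Poly_Mapping.single w (Poly_Mapping.lookup f w))"

definition identities_of_multidegree :: "nat list \<Rightarrow> 'a::field weyl set \<Rightarrow> (nat, 'a) falg set" where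
  "identities_of_multidegree ds V = {f. has_multidegree ds f \<and> weyl.polynomial_identity V f}"

section \<open>The polynomials\<close>

abbreviation X1 :: "(nat, 'a::field) falg" where "X1 \<equiv> var 0"
abbreviation X2 :: "(nat, 'a::field) falg" where "X2 \<equiv> var 1"
abbreviation X3 :: "(nat, 'a::field) falg" where "X3 \<equiv> var 2"

definition commutator :: "'b::ring \<Rightarrow> 'b \<Rightarrow> 'b" where
  "commutator a b = a * b - b * a"

definition St3 :: "'b::ring_1 \<Rightarrow> 'b \<Rightarrow> 'b \<Rightarrow> 'b" where
  "St3 z1 z2 z3 =
     (\<Sum>\<sigma> | \<sigma> permutes {..<3::nat}.
        of_int (sign \<sigma>) * [z1, z2, z3] ! \<sigma> 0 * [z1, z2, z3] ! \<sigma> 1 * [z1, z2, z3] ! \<sigma> 2)"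

definition Phi22 :: "'b::ring_1 \<Rightarrow> 'b \<Rightarrow> 'b" where
  "Phi22 a b = a^2 * b^2 - 3 * (a * b * a * b) + 2 * (a * b^2 * a)
     + 2 * (b * a^2 * b) - 3 * (b * a * b * a) + b^2 * a^2"

definition Phi211 :: "(nat, 'a::field) falg" where
  "Phi211 = multidegree_component [2, 1, 1] (Phi22 X1 (X2 + X3))"

definition Psi211 :: "(nat, 'a::field) falg" where
  "Psi211 = X1 * commutator X1 X2 * X3 + X3 * commutator X1 X2 * X1"

section \<open>Bases\<close>

text \<open>A basis given by an explicit enumeration; the listed elements are required to be pairwise
  distinct, so that \<open>length fs\<close> is the dimension of \<open>W\<close>.\<close>

definition is_basis_of :: "(nat, 'a::field) falg list \<Rightarrow> (nat, 'a) falg set \<Rightarrow> bool" where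
  "is_basis_of fs W \<longleftrightarrow>
     distinct fs \<and> falg.independent (set fs) \<and> falg.span (set fs) = W"

end

theory Submission
  imports Defs
begin

text \<open>The Weyl algebra acts faithfully on its normal forms \<open>\<Sum> a\<^sub>k y\<^sup>k\<close> by left multiplication, in every
  characteristic. Hence a polynomial is an identity of \<open>F[x] y\<close> iff the normal form of each of its
  evaluations vanishes, which is a system of polynomial equations in \<open>a\<close>, \<open>b\<close>, \<open>c\<close> and their
  derivatives when \<open>x\<^sub>1, x\<^sub>2, x\<^sub>3\<close> are replaced by \<open>a y\<close>, \<open>b y\<close>, \<open>c y\<close>. In characteristic 2 second
  derivatives vanish, whence the additional identities. Conversely, the substitutions
  \<open>(a, b, c) = (x, 1, x), (x, 1, x\<^sup>2), (x, x, 1)\<close> yield linear equations on the 12 coefficients of an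
  identity that span a lattice of rank 9 over the integers and of rank 8 modulo 2.\<close>

section \<open>Free algebras\<close>

text \<open>Evaluation and action are additive in the polynomial, so facts about them need checking
  on monomials only.\<close>

lemma poly_mapping_induct_single [case_names zero single add]:
  fixes f :: "'k \<Rightarrow>\<^sub>0 'a::comm_monoid_add"
  assumes "P 0" "\<And>k c. P (Poly_Mapping.single k c)" "\<And>f g. P f \<Longrightarrow> P g \<Longrightarrow> P (f + g)"
  shows "P f"
proof (induction f rule: update_induct)
  case const
  show ?case by (rule assms)
next
  case (update f k v)
  have "Poly_Mapping.update k v f = f + Poly_Mapping.single k v"
    using update.hyps(1)
    by (intro poly_mapping_eqI) (auto simp: lookup_update lookup_add lookup_single when_def in_keys_iff)
  then show ?case
    using update.IH assms by simp
qed

lemma falg_scale_single [simp]: "falg_scale c (Poly_Mapping.single w d) = Poly_Mapping.single w (c * d)"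
  by (simp add: falg_scale_conv_mult mult_single)

context assoc_algebra
begin

lemma eval_0 [simp]: "eval a 0 = 0"
  by (simp add: eval_def)

lemma eval_add: "eval a (f + g) = eval a f + eval a g"
  unfolding eval_def by (rule setsum_keys_plus_distrib) (simp_all add: scale_left_distrib)

lemma eval_single: "eval a (Poly_Mapping.single w c) = scale c (prod_list (map a (letters w)))"
  by (cases "c = 0") (simp_all add: eval_def)

end

section \<open>Normal forms in the Weyl algebra\<close>

text \<open>An element \<open>\<Sum> a\<^sub>k y\<^sup>k\<close> of the Weyl algebra is encoded as a polynomial in \<open>y\<close> over \<open>F[x]\<close>, on
  which the Weyl algebra acts by left multiplication.\<close>

definition y_act :: "'a::field poly poly \<Rightarrow> 'a poly poly" where
  "y_act v = pCons 0 v + map_poly pderiv v"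

primrec gen_act :: "weyl_gen \<Rightarrow> 'a::field poly poly \<Rightarrow> 'a poly poly" where
  "gen_act GX = smult [:0, 1:]"
| "gen_act GY = y_act"

text \<open>\<open>foldr\<close> lets the last letter act first, so that concatenation of words
  becomes composition of operators.\<close>

definition falg_act :: "(weyl_gen, 'a::field) falg \<Rightarrow> 'a poly poly \<Rightarrow> 'a poly poly" where
  "falg_act f v = (\<Sum>w\<in>Poly_Mapping.keys f. smult [:Poly_Mapping.lookup f w:] (foldr gen_act (letters w) v))"

lemma coeff_map_pderiv [simp]: "coeff (map_poly pderiv v) n = pderiv (coeff v n)"
  by (simp add: coeff_map_poly)

lemma y_act_0 [simp]: "y_act 0 = 0"
  by (simp add: y_act_def)

lemma y_act_add: "y_act (u + v) = y_act u + y_act v"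
  by (rule poly_eqI) (simp add: y_act_def coeff_pCons pderiv_add split: nat.split)

text \<open>The Leibniz rule: moving \<open>y\<close> past a coefficient \<open>a\<close> costs the
  extra term \<open>a'\<close>, as in \<open>y a = a y + a'\<close>.\<close>

lemma y_act_smult: "y_act (smult a v) = smult a (y_act v) + smult (pderiv a) v"
  by (rule poly_eqI) (simp add: y_act_def coeff_pCons pderiv_mult algebra_simps split: nat.split)

lemma gen_act_add: "gen_act g (u + v) = gen_act g u + gen_act g v"
  by (cases g) (simp_all add: y_act_add smult_add_right)

lemma gen_act_smult_const: "gen_act g (smult [:c:] v) = smult [:c:] (gen_act g v)"
  by (cases g) (simp_all add: y_act_smult)

lemma foldr_gen_act_add: "foldr gen_act l (u + v) = foldr gen_act l u + foldr gen_act l v"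
  by (induction l) (simp_all add: gen_act_add)

lemma foldr_gen_act_smult_const: "foldr gen_act l (smult [:c:] v) = smult [:c:] (foldr gen_act l v)"
  by (induction l) (simp_all add: gen_act_smult_const)

lemma falg_act_0 [simp]: "falg_act 0 v = 0"
  by (simp add: falg_act_def)

lemma falg_act_single:
  "falg_act (Poly_Mapping.single w c) v = smult [:c:] (foldr gen_act (letters w) v)"
  by (cases "c = 0") (simp_all add: falg_act_def)

lemma falg_act_add: "falg_act (f + g) v = falg_act f v + falg_act g v"
  unfolding falg_act_def
  by (rule setsum_keys_plus_distrib) (simp_all flip: smult_add_left)

lemma falg_act_diff: "falg_act (f - g) v = falg_act f v - falg_act g v"
  using falg_act_add[of "f - g" g v] by simp

lemma falg_act_add_right: "falg_act f (u + v) = falg_act f u + falg_act f v"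
  by (induction f rule: poly_mapping_induct_single)
    (simp_all add: falg_act_single falg_act_add foldr_gen_act_add smult_add_right)

lemma falg_act_zero_right [simp]: "falg_act f 0 = 0"
  using falg_act_add_right[of f 0 0] by (simp only: add_0_right add_cancel_right_right)

lemma falg_act_mult: "falg_act (f * g) v = falg_act f (falg_act g v)"
proof (induction f rule: poly_mapping_induct_single)
  case (single w c)
  show ?case
  proof (induction g rule: poly_mapping_induct_single)
    case (single w' c')
    show ?case
      by (simp add: mult_single falg_act_single plus_word_def foldr_gen_act_smult_const mult.commute)
  qed (simp_all add: distrib_left falg_act_add falg_act_add_right)
qed (simp_all add: distrib_right falg_act_add)

lemma falg_act_one [simp]: "falg_act 1 v = v"
  by (simp add: falg_act_single zero_word_def pCons_one flip: single_one)

text \<open>By the Leibniz rule \<open>y (x v) - x (y v) = x' v = v\<close>, so the defining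
  relation acts as zero. Hence the action descends to the quotient.\<close>

lemma falg_act_weyl_ideal: "f \<in> weyl_ideal \<Longrightarrow> falg_act f v = 0"
proof (induction arbitrary: v rule: weyl_ideal.induct)
  case (relation f g)
  have "falg_act (var GY * var GX - var GX * var GY - 1) u = 0" for u :: "'a poly poly"
    by (simp add: falg_act_diff falg_act_mult var_def falg_act_single y_act_smult pderiv_pCons pCons_one)
  then show ?case
    by (simp add: falg_act_mult)
qed (simp_all add: falg_act_add)

lift_definition weyl_act :: "'a::field weyl \<Rightarrow> 'a poly poly \<Rightarrow> 'a poly poly" is falg_act
proof
  fix f g :: "(weyl_gen, 'a) falg" and v
  assume "weyl_rel f g"
  then have "falg_act (f - g) v = 0"
    by (simp add: weyl_rel_def falg_act_weyl_ideal)
  then show "falg_act f v = falg_act g v"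
    by (simp add: falg_act_diff)
qed

lemma weyl_act_0 [simp]: "weyl_act 0 v = 0"
  by transfer simp

lemma weyl_act_one [simp]: "weyl_act 1 v = v"
  by transfer simp

lemma weyl_act_add: "weyl_act (s + t) v = weyl_act s v + weyl_act t v"
  by transfer (rule falg_act_add)

lemma weyl_act_mult: "weyl_act (s * t) v = weyl_act s (weyl_act t v)"
  by transfer (rule falg_act_mult)

lemma weyl_act_scale: "weyl_act (weyl_scale c s) v = smult [:c:] (weyl_act s v)"
  by transfer (simp add: falg_scale_conv_mult falg_act_mult falg_act_single zero_word_def)

lemma weyl_act_x: "weyl_act weyl_x v = smult [:0, 1:] v"
  by transfer (simp add: var_def falg_act_single pCons_one)

lemma weyl_act_y: "weyl_act weyl_y v = y_act v"
  by transfer (simp add: var_def falg_act_single pCons_one)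

lemma weyl_relation: "weyl_y * weyl_x = weyl_x * weyl_y + 1"
  by transfer (use weyl_ideal.relation[of 1 1] in \<open>simp add: weyl_rel_def diff_diff_eq\<close>)

section \<open>Passing between normal forms and elements of the Weyl algebra\<close>

lemma weyl_of_poly_0 [simp]: "weyl_of_poly 0 = 0"
  by (simp add: weyl_of_poly_def)

lemma weyl_of_poly_conv_sum:
  assumes "degree p \<le> n"
  shows "weyl_of_poly p = (\<Sum>i\<le>n. weyl_scale (coeff p i) (weyl_x ^ i))"
  unfolding weyl_of_poly_def
  by (rule sum.mono_neutral_left) (use assms in \<open>auto simp: coeff_eq_0\<close>)

lemma weyl_of_poly_add: "weyl_of_poly (p + q) = weyl_of_poly p + weyl_of_poly q"
proof -
  let ?n = "max (degree p) (degree q)"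
  show ?thesis
    using degree_add_le_max[of p q]
    by (simp add: weyl_of_poly_conv_sum[where n = ?n] weyl.scale_left_distrib sum.distrib)
qed

lemma weyl_of_poly_pCons: "weyl_of_poly (pCons c p) = weyl_scale c 1 + weyl_x * weyl_of_poly p"
proof -
  have "weyl_of_poly (pCons c p) = (\<Sum>i\<le>Suc (degree p). weyl_scale (coeff (pCons c p) i) (weyl_x ^ i))"
    by (rule weyl_of_poly_conv_sum) (rule degree_pCons_le)
  also have "\<dots> = weyl_scale c 1 + (\<Sum>i\<le>degree p. weyl_scale (coeff p i) (weyl_x * weyl_x ^ i))"
    by (simp add: sum.atMost_Suc_shift del: sum.atMost_Suc)
  finally show ?thesis
    by (simp add: weyl_of_poly_def sum_distrib_left weyl.scale_mult_right)
qed

lemma weyl_of_poly_smult: "weyl_of_poly (smult c p) = weyl_scale c (weyl_of_poly p)"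
  by (induction p)
    (simp_all add: weyl_of_poly_pCons weyl.scale_right_distrib weyl.scale_mult_right)

lemma weyl_of_poly_mult: "weyl_of_poly (p * q) = weyl_of_poly p * weyl_of_poly q"
  by (induction p)
    (simp_all add: weyl_of_poly_pCons weyl_of_poly_add weyl_of_poly_smult distrib_right
      weyl.scale_mult_left mult.assoc)

text \<open>Induction over \<open>p = c + x q\<close>: moving \<open>y\<close> past \<open>x\<close>
  costs one summand \<open>q\<close>, just as in \<open>(x q)' = q + x q'\<close>.\<close>

lemma weyl_y_mult_of_poly:
  "weyl_y * weyl_of_poly p = weyl_of_poly p * weyl_y + weyl_of_poly (pderiv p)"
proof (induction p)
  case (pCons c p)
  have "weyl_y * (weyl_x * weyl_of_poly p) = weyl_x * (weyl_y * weyl_of_poly p) + weyl_of_poly p"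
    by (simp add: weyl_relation distrib_right flip: mult.assoc)
  then show ?case
    by (simp add: pCons.IH weyl_of_poly_pCons pderiv_pCons weyl_of_poly_add distrib_left distrib_right
      weyl.scale_mult_left weyl.scale_mult_right mult.assoc)
qed simp

lemma weyl_act_of_poly: "weyl_act (weyl_of_poly p) v = smult p v"
proof (induction p)
  case (pCons c p)
  have "smult (pCons c p) v = smult [:c:] v + smult [:0, 1:] (smult p v)"
    by (simp flip: smult_add_left)
  then show ?case
    by (simp add: pCons.IH weyl_of_poly_pCons weyl_act_add weyl_act_mult weyl_act_scale weyl_act_x)
qed simp

text \<open>Horner's scheme, with \<open>y\<close> multiplied from the right because the
  coefficients stand to the left of the powers of \<open>y\<close>.\<close>

definition weyl_of_nf :: "'a::field poly poly \<Rightarrow> 'a weyl" where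
  "weyl_of_nf v = fold_coeffs (\<lambda>c s. weyl_of_poly c + s * weyl_y) v 0"

lemma weyl_of_nf_0 [simp]: "weyl_of_nf 0 = 0"
  by (simp add: weyl_of_nf_def)

lemma weyl_of_nf_pCons [simp]: "weyl_of_nf (pCons c v) = weyl_of_poly c + weyl_of_nf v * weyl_y"
  by (cases "c = 0 \<and> v = 0")
    (auto simp: weyl_of_nf_def fold_coeffs_pCons_coeff_not_0_eq fold_coeffs_pCons_not_0_0_eq)

lemma weyl_of_nf_add: "weyl_of_nf (u + v) = weyl_of_nf u + weyl_of_nf v"
  by (induction u v rule: poly_induct2)
    (simp_all add: weyl_of_poly_add distrib_right algebra_simps)

lemma weyl_of_nf_smult: "weyl_of_nf (smult a v) = weyl_of_poly a * weyl_of_nf v"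
  by (induction v) (simp_all add: weyl_of_poly_mult distrib_left mult.assoc)

lemma map_poly_pderiv_pCons: "map_poly pderiv (pCons c v) = pCons (pderiv c) (map_poly pderiv v)"
  by (simp add: map_poly_pCons)

lemma weyl_of_nf_y_act: "weyl_of_nf (y_act v) = weyl_y * weyl_of_nf v"
proof (induction v)
  case (pCons c v)
  \<comment> \<open>This is \<open>y (c + v y) = c y + c' + (y v) y\<close>, written for normal
    forms.\<close>
  have "y_act (pCons c v) = pCons 0 [:c:] + [:pderiv c:] + pCons 0 (y_act v)"
    by (simp add: y_act_def map_poly_pderiv_pCons)
  then show ?case
    by (simp add: weyl_of_nf_add pCons.IH weyl_y_mult_of_poly algebra_simps)
qed simp

lemma weyl_of_nf_1 [simp]: "weyl_of_nf 1 = 1"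
  by (simp add: one_pCons weyl_of_poly_pCons)

section \<open>Identities of the subspace\<close>

text \<open>The elements \<open>a y\<close> already form a subspace, so each variable is replaced by
  a single \<open>a y\<close> rather than by a sum of such.\<close>

lemma weyl_minus_1_eq: "weyl_minus_1 = range (\<lambda>p. weyl_of_poly p * weyl_y)"
proof -
  have "weyl.subspace (range (\<lambda>p :: 'a poly. weyl_of_poly p * weyl_y))"
  proof (rule weyl.subspaceI)
    show "0 \<in> range (\<lambda>p :: 'a poly. weyl_of_poly p * weyl_y)"
      by (rule range_eqI[where x = 0]) simp
    fix s t :: "'a weyl" and c :: 'a
    assume "s \<in> range (\<lambda>p. weyl_of_poly p * weyl_y)" "t \<in> range (\<lambda>p. weyl_of_poly p * weyl_y)"
    then obtain p q where "s = weyl_of_poly p * weyl_y" "t = weyl_of_poly q * weyl_y"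
      by blast
    then have "s + t = weyl_of_poly (p + q) * weyl_y" "weyl_scale c s = weyl_of_poly (smult c p) * weyl_y"
      by (simp_all add: weyl_of_poly_add weyl_of_poly_smult distrib_right weyl.scale_mult_left)
    then show "s + t \<in> range (\<lambda>p. weyl_of_poly p * weyl_y)"
      and "weyl_scale c s \<in> range (\<lambda>p. weyl_of_poly p * weyl_y)"
      by blast+
  qed
  then have "weyl.span (range (\<lambda>p :: 'a poly. weyl_of_poly p * weyl_y)) = range (\<lambda>p. weyl_of_poly p * weyl_y)"
    by (simp only: weyl.span_eq_iff)
  moreover have "{weyl_of_poly p * weyl_y | p :: 'a poly. True} = range (\<lambda>p. weyl_of_poly p * weyl_y)"
    by blast
  ultimately show ?thesis
    by (simp only: weyl_minus_1_def)
qed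

text \<open>Left multiplication by \<open>a y\<close>, where \<open>a y\<close> is thought of as the
  vector field \<open>a d/dx\<close>.\<close>

definition vf_act :: "'a::field poly \<Rightarrow> 'a poly poly \<Rightarrow> 'a poly poly" where
  "vf_act a v = smult a (y_act v)"

definition word_nf :: "('v \<Rightarrow> 'a::field poly) \<Rightarrow> 'v list \<Rightarrow> 'a poly poly" where
  "word_nf p w = foldr (\<lambda>v. vf_act (p v)) w 1"

lemma word_nf_Nil [simp]: "word_nf p [] = 1"
  by (simp add: word_nf_def)

lemma word_nf_Cons [simp]: "word_nf p (v # w) = vf_act (p v) (word_nf p w)"
  by (simp add: word_nf_def)

lemma prod_list_conv_weyl_of_nf:
  "prod_list (map (\<lambda>v. weyl_of_poly (p v) * weyl_y) w) = weyl_of_nf (word_nf p w)"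
  by (induction w) (simp_all add: vf_act_def weyl_of_nf_smult weyl_of_nf_y_act mult.assoc)

lemma weyl_act_prod_list:
  "weyl_act (prod_list (map (\<lambda>v. weyl_of_poly (p v) * weyl_y) w)) 1 = word_nf p w"
  by (induction w) (simp_all add: vf_act_def weyl_act_mult weyl_act_of_poly weyl_act_y)

text \<open>An element with normal form \<open>v\<close> sends \<open>1\<close> to \<open>v\<close>,
  so acting on \<open>1\<close> extracts the normal form of the evaluation.\<close>

definition eval_nf :: "('v \<Rightarrow> 'a::field poly) \<Rightarrow> ('v, 'a) falg \<Rightarrow> 'a poly poly" where
  "eval_nf p f = weyl_act (weyl.eval (\<lambda>v. weyl_of_poly (p v) * weyl_y) f) 1"

lemma eval_nf_0 [simp]: "eval_nf p 0 = 0"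
  by (simp add: eval_nf_def)

lemma eval_nf_add: "eval_nf p (f + g) = eval_nf p f + eval_nf p g"
  by (simp add: eval_nf_def weyl.eval_add weyl_act_add)

lemma eval_nf_single: "eval_nf p (Poly_Mapping.single w c) = smult [:c:] (word_nf p (letters w))"
  by (simp add: eval_nf_def weyl.eval_single weyl_act_scale weyl_act_prod_list)

text \<open>Linearity reduces this to words, where \<open>weyl_of_nf\<close> turns each operator
  \<open>vf_act a\<close> into left multiplication by \<open>a y\<close>. Consequently an evaluation
  with zero normal form is zero.\<close>

lemma weyl_of_nf_eval_nf:
  "weyl_of_nf (eval_nf p f) = weyl.eval (\<lambda>v. weyl_of_poly (p v) * weyl_y) f"
  by (induction f rule: poly_mapping_induct_single)
    (simp_all add: eval_nf_add eval_nf_single weyl.eval_add weyl.eval_single weyl_of_nf_add weyl_of_nf_smult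
      weyl_of_poly_pCons weyl.scale_mult_left prod_list_conv_weyl_of_nf)

lemma polynomial_identity_weyl_minus_1_iff:
  fixes f :: "('v, 'a::field) falg"
  shows "weyl.polynomial_identity weyl_minus_1 f \<longleftrightarrow> (\<forall>p. eval_nf p f = 0)"
proof
  assume "weyl.polynomial_identity weyl_minus_1 f"
  then show "\<forall>p. eval_nf p f = 0"
    by (simp add: weyl.polynomial_identity_def weyl_minus_1_eq eval_nf_def)
next
  assume *: "\<forall>p. eval_nf p f = 0"
  show "weyl.polynomial_identity weyl_minus_1 f"
    unfolding weyl.polynomial_identity_def weyl_minus_1_eq
  proof (intro allI impI)
    fix a :: "'v \<Rightarrow> 'a weyl"
    assume "\<forall>v. a v \<in> range (\<lambda>p. weyl_of_poly p * weyl_y)"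
    then obtain p where "\<And>v. a v = weyl_of_poly (p v) * weyl_y"
      unfolding image_iff by (metis UNIV_I)
    then have "a = (\<lambda>v. weyl_of_poly (p v) * weyl_y)"
      by blast
    then show "weyl.eval a f = 0"
      using * by (simp flip: weyl_of_nf_eval_nf)
  qed
qed

section \<open>Linear combinations of words\<close>

text \<open>For a fixed list of distinct words, equations between polynomials become equations
  between coefficient lists.\<close>

definition word_comb :: "'v list list \<Rightarrow> 'a::field list \<Rightarrow> ('v, 'a) falg" where
  "word_comb ws cs = (\<Sum>(w, c)\<leftarrow>zip ws cs. Poly_Mapping.single (Word w) c)"

lemma word_comb_Nil [simp]: "word_comb [] cs = 0" "word_comb ws [] = 0"
  by (simp_all add: word_comb_def)

lemma word_comb_Cons [simp]:
  "word_comb (w # ws) (c # cs) = Poly_Mapping.single (Word w) c + word_comb ws cs"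
  by (simp add: word_comb_def)

lemma falg_scale_word_comb: "falg_scale k (word_comb ws cs) = word_comb ws (map ((*) k) cs)"
  by (induction ws cs rule: list_induct2') (simp_all add: falg.scale_right_distrib)

lemma word_comb_add:
  "length cs = length ds \<Longrightarrow> word_comb ws cs + word_comb ws ds = word_comb ws (map2 (+) cs ds)"
proof (induction cs ds arbitrary: ws rule: list_induct2)
  case (Cons c cs d ds)
  then show ?case
    by (cases ws) (simp_all add: single_add add.left_commute add.assoc flip: Cons.IH)
qed simp

lemma lookup_word_comb_notin: "w \<notin> set ws \<Longrightarrow> Poly_Mapping.lookup (word_comb ws cs) (Word w) = 0"
  by (induction ws cs rule: list_induct2') (auto simp: lookup_add lookup_single)

lemma word_comb_lookup:
  "distinct ws \<Longrightarrow> length cs = length ws \<Longrightarrow>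
     map (\<lambda>w. Poly_Mapping.lookup (word_comb ws cs) (Word w)) ws = cs"
proof (induction ws cs rule: list_induct2')
  case (4 w ws c cs)
  then have "map (\<lambda>u. Poly_Mapping.lookup (word_comb (w # ws) (c # cs)) (Word u)) ws =
      map (\<lambda>u. Poly_Mapping.lookup (word_comb ws cs) (Word u)) ws"
    by (intro map_cong) (auto simp: lookup_add lookup_single when_def)
  also have "\<dots> = cs"
    using 4 by simp
  finally show ?case
    using 4 by (simp add: lookup_add lookup_word_comb_notin del: map_eq_conv)
qed simp_all

lemma word_comb_eq_iff:
  "distinct ws \<Longrightarrow> length cs = length ws \<Longrightarrow> length ds = length ws \<Longrightarrow>
     word_comb ws cs = word_comb ws ds \<longleftrightarrow> cs = ds"
  by (metis word_comb_lookup)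

lemma word_comb_of_lookup:
  assumes "distinct ws" "Poly_Mapping.keys f \<subseteq> Word ` set ws"
  shows "word_comb ws (map (\<lambda>w. Poly_Mapping.lookup f (Word w)) ws) = f"
proof (rule poly_mapping_eqI)
  fix u :: "'a word"
  show "Poly_Mapping.lookup (word_comb ws (map (\<lambda>w. Poly_Mapping.lookup f (Word w)) ws)) u =
      Poly_Mapping.lookup f u"
  proof (cases "letters u \<in> set ws")
    case True
    have "map (\<lambda>w. Poly_Mapping.lookup (word_comb ws (map (\<lambda>w. Poly_Mapping.lookup f (Word w)) ws)) (Word w)) ws =
        map (\<lambda>w. Poly_Mapping.lookup f (Word w)) ws"
      using assms(1) by (rule word_comb_lookup) simp
    with True show ?thesis
      by (metis map_eq_conv word.collapse)
  next
    case False
    then have "u \<notin> Poly_Mapping.keys f"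
      using assms(2) by (auto simp del: lookup_not_eq_zero_eq_in_keys)
    with False show ?thesis
      by (metis in_keys_iff lookup_word_comb_notin word.collapse)
  qed
qed

lemma keys_word_comb: "Poly_Mapping.keys (word_comb ws cs) \<subseteq> Word ` set ws"
proof
  fix u
  assume "u \<in> Poly_Mapping.keys (word_comb ws cs)"
  then have "letters u \<in> set ws"
    by (metis in_keys_iff lookup_word_comb_notin word.collapse)
  then show "u \<in> Word ` set ws"
    by (metis imageI word.collapse)
qed

section \<open>Spans and independence of finite lists\<close>

definition lincomb :: "'a::field list \<Rightarrow> ('v, 'a) falg list \<Rightarrow> ('v, 'a) falg" where
  "lincomb cs fs = (\<Sum>(c, f)\<leftarrow>zip cs fs. falg_scale c f)"

lemma lincomb_Nil [simp]: "lincomb [] fs = 0" "lincomb cs [] = 0"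
  by (simp_all add: lincomb_def)

lemma lincomb_Cons [simp]: "lincomb (c # cs) (f # fs) = falg_scale c f + lincomb cs fs"
  by (simp add: lincomb_def)

lemma falg_span_list: "falg.span (set fs) = {lincomb cs fs |cs. length cs = length fs}"
proof (induction fs)
  case (Cons f fs)
  show ?case
  proof (intro set_eqI iffI)
    fix g
    assume "g \<in> falg.span (set (f # fs))"
    then obtain c where "g - falg_scale c f \<in> falg.span (set fs)"
      by (auto simp: falg.span_insert)
    then obtain cs where "g - falg_scale c f = lincomb cs fs" "length cs = length fs"
      by (auto simp: Cons.IH)
    then have "g = lincomb (c # cs) (f # fs)" "length (c # cs) = length (f # fs)"
      by (simp_all add: diff_eq_eq add.commute)
    then show "g \<in> {lincomb cs (f # fs) |cs. length cs = length (f # fs)}"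
      by blast
  next
    fix g
    assume "g \<in> {lincomb cs (f # fs) |cs. length cs = length (f # fs)}"
    then obtain cs where "g = lincomb cs (f # fs)" "length cs = length (f # fs)"
      by blast
    moreover from this obtain c cs' where "cs = c # cs'"
      by (cases cs) auto
    ultimately have "g - falg_scale c f = lincomb cs' fs" "length cs' = length fs"
      by simp_all
    then show "g \<in> falg.span (set (f # fs))"
      using Cons.IH by (auto simp: falg.span_insert)
  qed
qed simp

text \<open>An entry in the span of the later ones would give a relation with coefficient
  \<open>- 1\<close>. A repeated entry lies in that span as well, so distinctness comes along with
  independence.\<close>

lemma falg_independent_list:
  assumes "\<And>cs. length cs = length fs \<Longrightarrow> lincomb cs fs = 0 \<Longrightarrow> set cs \<subseteq> {0}"
  shows "distinct fs \<and> falg.independent (set fs)"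
  using assms
proof (induction fs)
  case (Cons f fs)
  have "set cs \<subseteq> {0}" if "length cs = length fs" "lincomb cs fs = 0" for cs
    using Cons.prems[of "0 # cs"] that by simp
  then have IH: "distinct fs" "falg.independent (set fs)"
    using Cons.IH by simp_all
  have "f \<notin> falg.span (set fs)"
  proof
    assume "f \<in> falg.span (set fs)"
    then obtain cs where "f = lincomb cs fs" "length cs = length fs"
      by (auto simp: falg_span_list)
    then show False
      using Cons.prems[of "- 1 # cs"] by (simp add: falg.scale_minus_left)
  qed
  then show ?case
    using IH by (auto simp: falg.independent_insert falg.span_base)
qed (simp add: falg.independent_empty)

lemma is_basis_ofI:
  assumes "\<And>cs. length cs = length fs \<Longrightarrow> lincomb cs fs = 0 \<Longrightarrow> set cs \<subseteq> {0}"
    and "{lincomb cs fs |cs. length cs = length fs} = W"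
  shows "is_basis_of fs W"
  using falg_independent_list[OF assms(1)] assms(2) by (simp add: is_basis_of_def falg_span_list)

section \<open>Multidegree (2,1,1)\<close>

text \<open>The \<open>4! / 2! = 12\<close> arrangements of the letters \<open>0, 0, 1, 2\<close> in
  lexicographic order. The coefficient lists of length 12 below refer to this order.\<close>

abbreviation words211 :: "nat list list" where
  "words211 \<equiv> [[0,0,1,2], [0,0,2,1], [0,1,0,2], [0,1,2,0], [0,2,0,1], [0,2,1,0],
     [1,0,0,2], [1,0,2,0], [1,2,0,0], [2,0,0,1], [2,0,1,0], [2,1,0,0]]"

lemma word_has_multidegree_211_iff: "word_has_multidegree [2, 1, 1] w \<longleftrightarrow> w \<in> Word ` set words211"
proof
  assume *: "word_has_multidegree [2, 1, 1] w"
  \<comment> \<open>Adding up the counts gives length \<open>2 + 1 + 1 = 4\<close>, which leaves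
    finitely many words.\<close>
  then have "(\<Sum>i<3. count_list (letters w) i) = length (letters w)"
    by (intro sum_count_set) (simp_all add: word_has_multidegree_def numeral_3_eq_3)
  with * have "length (letters w) = 4"
    by (simp add: word_has_multidegree_def eval_nat_numeral All_less_Suc)
  then obtain a b c d where w: "letters w = [a, b, c, d]"
    by (auto simp: length_Suc_conv eval_nat_numeral)
  with * have "{a, b, c, d} \<subseteq> {0, 1, 2}" and
    cnt: "count_list [a, b, c, d] 0 = 2" "count_list [a, b, c, d] 1 = 1" "count_list [a, b, c, d] 2 = 1"
    by (auto simp: word_has_multidegree_def eval_nat_numeral All_less_Suc less_Suc_eq)
  then have "[a, b, c, d] \<in> set words211"
    by (simp split: if_splits)
  then show "w \<in> Word ` set words211"
    using w by (metis imageI word.collapse)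
next
  assume "w \<in> Word ` set words211"
  then show "word_has_multidegree [2, 1, 1] w"
    by (auto simp: word_has_multidegree_def eval_nat_numeral All_less_Suc)
qed

lemma has_multidegree_211_iff:
  "has_multidegree [2, 1, 1] f \<longleftrightarrow> (\<exists>cs. length cs = 12 \<and> f = word_comb words211 cs)"
proof
  assume "has_multidegree [2, 1, 1] f"
  then have "Poly_Mapping.keys f \<subseteq> Word ` set words211"
    unfolding has_multidegree_def word_has_multidegree_211_iff by blast
  then have "f = word_comb words211 (map (\<lambda>w. Poly_Mapping.lookup f (Word w)) words211)"
    by (intro word_comb_of_lookup[symmetric]) simp_all
  moreover have "length (map (\<lambda>w. Poly_Mapping.lookup f (Word w)) words211) = 12"
    by simp
  ultimately show "\<exists>cs. length cs = 12 \<and> f = word_comb words211 cs"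
    by blast
next
  assume "\<exists>cs. length cs = 12 \<and> f = word_comb words211 cs"
  then show "has_multidegree [2, 1, 1] f"
    unfolding has_multidegree_def word_has_multidegree_211_iff
    using keys_word_comb by blast
qed

lemma multidegree_component_eqI:
  assumes "f = g + h" "has_multidegree ds g"
    "\<And>w. w \<in> Poly_Mapping.keys h \<Longrightarrow> \<not> word_has_multidegree ds w"
  shows "multidegree_component ds f = g"
proof (rule poly_mapping_eqI)
  fix u
  have "Poly_Mapping.lookup (multidegree_component ds f) u =
    (\<Sum>w\<in>{w \<in> Poly_Mapping.keys f. word_has_multidegree ds w}. if w = u then Poly_Mapping.lookup f w else 0)"
    by (simp add: multidegree_component_def lookup_sum lookup_single when_def)
  also have "\<dots> = (if word_has_multidegree ds u then Poly_Mapping.lookup f u else 0)"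
    by (auto simp: sum.delta in_keys_iff)
  also have "\<dots> = Poly_Mapping.lookup g u"
    using assms(2,3) by (auto simp: assms(1) lookup_add has_multidegree_def in_keys_iff)
  finally show "Poly_Mapping.lookup (multidegree_component ds f) u = Poly_Mapping.lookup g u" .
qed

section \<open>Coefficient lists of the given polynomials\<close>

lemma St3_eq: "St3 a b c = a * b * c + b * c * a + c * a * b - a * c * b - b * a * c - c * b * a"
proof -
  have 3: "{..<3::nat} = {0, 1, 2}"
    by auto
  have 1: "finite {1::nat, 2}" "0 \<notin> {1::nat, 2}" and 2: "finite {2::nat}" "1 \<notin> {2::nat}"
    by auto
  \<comment> \<open>Each of the six permutations is \<open>transpose 0 b\<close> composed with a
    permutation of \<open>{1, 2}\<close>, and those arise from \<open>{2}\<close> in the same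
    way.\<close>
  show ?thesis
    unfolding St3_def 3 sum_over_permutations_insert[OF 1] sum_over_permutations_insert[OF 2] permutes_sing
    by (simp add: sign_compose permutation_swap_id sign_swap_id permutation_compose sign_id transpose_def)
qed

lemma numeral_times_single:
  "numeral n * Poly_Mapping.single w c = Poly_Mapping.single (w :: 'v word) (numeral n * c :: 'a::field)"
  by (simp add: mult_single flip: single_numeral)

lemma times_St3_conv_word_comb:
  "X1 * St3 X1 X2 X3 = word_comb words211 [1,-1,-1,1,1,-1,0,0,0,0,0,0]"
  by (simp add: St3_eq var_def mult_single plus_word_def algebra_simps single_uminus)

lemma St3_times_conv_word_comb:
  "St3 X1 X2 X3 * X1 = word_comb words211 [0,0,0,1,0,-1,0,-1,1,0,1,-1]"
  by (simp add: St3_eq var_def mult_single plus_word_def algebra_simps single_uminus)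

lemma Psi211_conv_word_comb: "Psi211 = word_comb words211 [1,0,-1,0,0,0,0,0,0,0,1,-1]"
  by (simp add: Psi211_def commutator_def var_def mult_single plus_word_def algebra_simps single_uminus)

lemma commutator_conv_word_comb:
  "commutator (commutator X1 X2) (commutator X1 X3) =
     word_comb words211 [0,0,1,-1,-1,1,-1,1,0,1,-1,0]"
  by (simp add: commutator_def var_def mult_single plus_word_def algebra_simps single_uminus)

lemma Phi211_conv_word_comb: "Phi211 = word_comb words211 [1,1,-3,2,-3,2,2,-3,1,2,-3,1]"
proof -
  let ?g = "word_comb words211 [1,1,-3,2,-3,2,2,-3,1,2,-3,1] :: (nat, 'a) falg"
  \<comment> \<open>The words without \<open>X3\<close> and those without \<open>X2\<close>:
    \<open>?h\<close> is \<open>Phi22 X1 X2 + Phi22 X1 X3\<close>, the part of multidegrees (2,2,0)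
    and (2,0,2).\<close>
  let ?ws = "[[0,0,1,1], [0,1,0,1], [0,1,1,0], [1,0,0,1], [1,0,1,0], [1,1,0,0],
    [0,0,2,2], [0,2,0,2], [0,2,2,0], [2,0,0,2], [2,0,2,0], [2,2,0,0]] :: nat list list"
  let ?h = "word_comb ?ws [1,-3,2,2,-3,1,1,-3,2,2,-3,1] :: (nat, 'a) falg"
  have "Phi22 X1 (X2 + X3) = ?g + ?h"
    by (simp add: Phi22_def power2_eq_square var_def mult_single plus_word_def numeral_times_single
        algebra_simps single_uminus)
  moreover have "has_multidegree [2, 1, 1] ?g"
    unfolding has_multidegree_def word_has_multidegree_211_iff using keys_word_comb by blast
  moreover have "\<not> word_has_multidegree [2, 1, 1] w" if "w \<in> Poly_Mapping.keys ?h" for w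
  proof -
    have "w \<in> Word ` set ?ws"
      using that keys_word_comb by blast
    then show ?thesis
      unfolding word_has_multidegree_211_iff by auto
  qed
  ultimately show ?thesis
    unfolding Phi211_def by (rule multidegree_component_eqI)
qed

section \<open>Evaluations in multidegree (2,1,1)\<close>

lemma y_act_pCons: "y_act (pCons c v) = pCons (pderiv c) ([:c:] + y_act v)"
  by (simp add: y_act_def map_poly_pderiv_pCons)

text \<open>From \<open>a y (c + v y) = a c' + (a c + a y v) y\<close>: normal forms are computed
  from the lowest power of \<open>y\<close> upwards.\<close>

lemma vf_act_pCons: "vf_act a (pCons c v) = pCons (a * pderiv c) ([:a * c:] + vf_act a v)"
  by (simp add: vf_act_def y_act_pCons smult_add_right)

lemma vf_act_0 [simp]: "vf_act a 0 = 0"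
  by (simp add: vf_act_def)

lemma vf_act_1 [simp]: "vf_act a 1 = [:0, a:]"
  by (simp add: one_pCons vf_act_pCons)

lemmas eval_nf_simps = eval_nf_add eval_nf_single vf_act_pCons pderiv_mult pderiv_add

lemma eval_nf_scale: "eval_nf p (falg_scale k f) = smult [:k:] (eval_nf p f)"
  by (induction f rule: poly_mapping_induct_single)
    (simp_all add: eval_nf_add eval_nf_single falg.scale_right_distrib smult_add_right mult.commute)

lemma eval_nf_lincomb: "(\<And>f. f \<in> set fs \<Longrightarrow> eval_nf p f = 0) \<Longrightarrow> eval_nf p (lincomb cs fs) = 0"
  by (induction cs fs rule: list_induct2') (simp_all add: eval_nf_add eval_nf_scale)

text \<open>Already \<open>St3\<close> vanishes: it is the cyclic sum of \<open>u [v, w]\<close>,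
  and \<open>[b y, c y] = (b c' - b' c) y\<close>, so the coefficients of \<open>y^2\<close> and of
  \<open>y\<close> cancel cyclically.\<close>

lemma eval_nf_times_St3: "eval_nf p (X1 * St3 X1 X2 X3) = 0"
  unfolding times_St3_conv_word_comb by (simp add: eval_nf_simps algebra_simps)

lemma eval_nf_St3_times: "eval_nf p (St3 X1 X2 X3 * X1) = 0"
  unfolding St3_times_conv_word_comb by (simp add: eval_nf_simps algebra_simps)

lemma smult_numeral: "smult (numeral n) q = numeral n * q"
  by (simp add: numeral_poly)

text \<open>With \<open>h = [u, v]\<close>, \<open>Phi22 u v\<close> equals
  \<open>u h v - v h u - 2 h^2\<close>. For \<open>u = a y\<close>, \<open>v = b y\<close> and
  \<open>w = a b' - a' b\<close> one has \<open>h = w y\<close>, and both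
  \<open>u h v - v h u\<close> and \<open>2 h^2\<close> equal \<open>2 w^2 y^2 + 2 w w' y\<close>.
  Linearizing in \<open>v\<close> preserves the identity.\<close>

lemma eval_nf_Phi211: "eval_nf p Phi211 = 0"
  unfolding Phi211_conv_word_comb
  by (simp add: eval_nf_simps smult_numeral) (intro conjI; algebra)

text \<open>The second derivative of \<open>x^n\<close> has the even factor
  \<open>n (n - 1)\<close>; in the induction this is \<open>(x q)'' = 2 q' + x q''\<close>.\<close>

lemma pderiv_pderiv_char_2:
  assumes "(2::'a::field) = 0"
  shows "pderiv (pderiv (q :: 'a poly)) = 0"
proof (induction q)
  case (pCons c q)
  have "pderiv q + pderiv q = smult 2 (pderiv q)"
    by (simp add: smult_numeral)
  with pCons.IH show ?case
    by (simp add: pderiv_pCons pderiv_add assms)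
qed simp

text \<open>The coefficients of \<open>y^3\<close> and \<open>y^2\<close> are multiples of 2. That
  of \<open>y\<close> involves only second derivatives and \<open>w'\<close> for
  \<open>w = a b' - a' b\<close>, and \<open>w' = a b'' - a'' b\<close> vanishes too.\<close>

lemma eval_nf_Psi211:
  fixes p :: "nat \<Rightarrow> 'a::field poly"
  assumes "(2::'a) = 0"
  shows "eval_nf p Psi211 = 0"
proof -
  have "(2 :: 'a poly) = 0"
    using assms by (simp add: numeral_poly)
  then show ?thesis
    unfolding Psi211_conv_word_comb
    by (simp add: eval_nf_simps pderiv_pderiv_char_2[OF assms] algebra_simps)
qed

text \<open>The inner commutators are \<open>w y\<close> and \<open>t y\<close> with Wronskians
  \<open>w\<close>, \<open>t\<close>, whose derivatives vanish in characteristic 2; hence so does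
  \<open>[w y, t y] = (w t' - w' t) y\<close>.\<close>

lemma eval_nf_commutator:
  fixes p :: "nat \<Rightarrow> 'a::field poly"
  assumes "(2::'a) = 0"
  shows "eval_nf p (commutator (commutator X1 X2) (commutator X1 X3)) = 0"
  unfolding commutator_conv_word_comb
  by (simp add: eval_nf_simps pderiv_pderiv_char_2[OF assms] algebra_simps)

text \<open>The linear system is solved over the integers, to serve every characteristic. Eight
  relations leave \<open>c0\<close>, \<open>c1\<close>, \<open>c6\<close>, \<open>c8\<close> as
  parameters; the ninth lowers the dimension from 4 to 3 exactly where 2 is invertible.\<close>

lemma coeffs_of_identity:
  fixes c0 c1 c2 c3 c4 c5 c6 c7 c8 c9 c10 c11 :: "'a::field"
  assumes "\<And>p. eval_nf p (word_comb words211 [c0,c1,c2,c3,c4,c5,c6,c7,c8,c9,c10,c11]) = 0"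
  shows "c2 = - c0 - c6" "c3 = c8 + c6 - c1" "c4 = - c1 - c6" "c5 = c1 + c6 - c8" "c7 = - c8 - c6"
    "c9 = c6" "c10 = c8 - c0 - c1 - c6" "c11 = c0 + c1 - c8" "2 * c6 = 2 * (c0 + c1)"
proof -
  note [simp] = eval_nf_simps pderiv_pCons one_pCons
  \<comment> \<open>Coefficients of \<open>y\<close>, \<open>y^2\<close>, \<open>y^3\<close>,
    \<open>y^4\<close>, each a single monomial in \<open>x\<close>. The last one says that the
    coefficients sum to zero, since all words have the same leading term.\<close>
  have eqs1: "c6 + c7 + c8 = 0"
    "2*c0 + c1 + 4*c2 + 4*c3 + c4 + 2*c5 + 7*c6 + 7*c7 + 7*c8 + c9 + 2*c10 + 4*c11 = 0"
    "4*c0 + 3*c1 + 5*c2 + 5*c3 + 3*c4 + 4*c5 + 6*c6 + 6*c7 + 6*c8 + 3*c9 + 4*c10 + 5*c11 = 0"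
    "c0 + c1 + c2 + c3 + c4 + c5 + c6 + c7 + c8 + c9 + c10 + c11 = 0"
    using assms[of "\<lambda>i. [[:0,1:],1,[:0,1:]] ! i"] by (simp_all (no_asm_use) add: add.assoc) blast+
  \<comment> \<open>Only \<open>y\<close>, \<open>y^2\<close>, \<open>y^3\<close> here and in
    \<open>eqs3\<close>, since \<open>y^4\<close> gives the sum of the coefficients again.\<close>
  have eqs2: "2*c0 + 4*c2 + 2*c3 + 8*c6 + 4*c7 + 2*c8 = 0"
    "10*c0 + 4*c1 + 14*c2 + 10*c3 + 2*c4 + 4*c5 + 19*c6 + 14*c7 + 10*c8 + c9 + 2*c10 + 4*c11 = 0"
    "7*c0 + 5*c1 + 8*c2 + 7*c3 + 4*c4 + 5*c5 + 9*c6 + 8*c7 + 7*c8 + 3*c9 + 4*c10 + 5*c11 = 0"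
    using assms[of "\<lambda>i. [[:0,1:],1,[:0,0,1:]] ! i"] by (simp_all (no_asm_use) add: add.assoc) blast+
  have eqs3: "c9 + c10 + c11 = 0"
    "c0 + 2*c1 + c2 + 2*c3 + 4*c4 + 4*c5 + c6 + 2*c7 + 4*c8 + 7*c9 + 7*c10 + 7*c11 = 0"
    "3*c0 + 4*c1 + 3*c2 + 4*c3 + 5*c4 + 5*c5 + 3*c6 + 4*c7 + 5*c8 + 6*c9 + 6*c10 + 6*c11 = 0"
    using assms[of "\<lambda>i. [[:0,1:],[:0,1:],1] ! i"] by (simp_all (no_asm_use) add: add.assoc) blast+
  show "c2 = - c0 - c6" using eqs1 eqs2 eqs3 by algebra
  show "c3 = c8 + c6 - c1"  using eqs1 eqs2 eqs3 by algebra
  show "c4 = - c1 - c6"  using eqs1 eqs2 eqs3 by algebra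
  show "c5 = c1 + c6 - c8"  using eqs1 eqs2 eqs3 by algebra
  show "c7 = - c8 - c6" using eqs1 eqs2 eqs3 by algebra
  show "c9 = c6"  using eqs1 eqs2 eqs3 by algebra
  show "c10 = c8 - c0 - c1 - c6"  using eqs1 eqs2 eqs3 by algebra
  show "c11 = c0 + c1 - c8"  using eqs1 eqs2 eqs3 by algebra
  \<comment> \<open>The factor 2 cannot be cancelled: in characteristic 2 the double commutator has
    \<open>c6 = 1\<close> and \<open>c0 = c1 = 0\<close>.\<close>
  show "2 * c6 = 2 * (c0 + c1)" using eqs1 eqs2 eqs3 by algebra
qed

section \<open>The two bases\<close>

lemma lincomb_word_comb:
  "lincomb (k # ks) (word_comb ws ds # fs) = word_comb ws (map ((*) k) ds) + lincomb ks fs"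
  by (simp add: falg_scale_word_comb)

lemma lincomb_char_ne_2:
  "lincomb [a, b, c] [X1 * St3 X1 X2 X3, St3 X1 X2 X3 * X1, Phi211] =
     word_comb words211 [a + c, c - a, - a - 3 * c, a + b + 2 * c, a - 3 * c, 2 * c - a - b,
       2 * c, - b - 3 * c, b + c, 2 * c, b - 3 * c, c - b]"
  unfolding times_St3_conv_word_comb St3_times_conv_word_comb Phi211_conv_word_comb lincomb_word_comb
  by (simp add: word_comb_add algebra_simps del: word_comb_Cons)

lemma lincomb_char_2:
  "lincomb [a, b, c, d] [X1 * St3 X1 X2 X3, St3 X1 X2 X3 * X1, Psi211,
       commutator (commutator X1 X2) (commutator X1 X3)] =
     word_comb words211 [a + c, - a, d - a - c, a + b - d, a - d, d - a - b,
       - d, d - b, b, d, b + c - d, - b - c]"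
  unfolding times_St3_conv_word_comb St3_times_conv_word_comb Psi211_conv_word_comb
    commutator_conv_word_comb lincomb_word_comb
  by (simp add: word_comb_add algebra_simps del: word_comb_Cons)

lemma word_comb_words211_eq_0:
  assumes "word_comb words211 cs = 0" "length cs = 12"
  shows "set cs \<subseteq> {0}"
proof -
  have "word_comb words211 (replicate 12 0) = (0 :: (nat, 'a) falg)"
    by (simp add: numeral_eq_Suc)
  then have "word_comb words211 cs = word_comb words211 (replicate 12 0)"
    using assms(1) by simp
  then have "cs = replicate 12 0"
    by (subst (asm) word_comb_eq_iff) (simp_all add: assms(2))
  then show ?thesis
    by simp
qed

lemma identities_211_iff:
  "f \<in> identities_of_multidegree [2, 1, 1] weyl_minus_1 \<longleftrightarrow>
     (\<exists>cs. length cs = 12 \<and> f = word_comb words211 cs) \<and> (\<forall>p. eval_nf p f = 0)"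
  unfolding identities_of_multidegree_def
  by (simp only: mem_Collect_eq has_multidegree_211_iff polynomial_identity_weyl_minus_1_iff)

lemma length_12E:
  assumes "length cs = 12"
  obtains c0 c1 c2 c3 c4 c5 c6 c7 c8 c9 c10 c11 where "cs = [c0, c1, c2, c3, c4, c5, c6, c7, c8, c9, c10, c11]"
  using assms by (auto simp: numeral_eq_Suc length_Suc_conv)

lemma basis_char_ne_2:
  assumes "(2 :: 'a::field) \<noteq> 0"
  shows "is_basis_of [X1 * St3 X1 X2 X3, St3 X1 X2 X3 * X1, Phi211]
    (identities_of_multidegree [2, 1, 1] (weyl_minus_1 :: 'a weyl set))" (is "is_basis_of ?fs ?W")
proof (rule is_basis_ofI)
  fix cs :: "'a list"
  assume "length cs = length ?fs" and *: "lincomb cs ?fs = 0"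
  then obtain a b c where cs: "cs = [a, b, c]"
    by (auto simp: length_Suc_conv)
  have "set [a + c, c - a, - a - 3 * c, a + b + 2 * c, a - 3 * c, 2 * c - a - b,
      2 * c, - b - 3 * c, b + c, 2 * c, b - 3 * c, c - b] \<subseteq> {0}"
    using *[unfolded cs lincomb_char_ne_2] by (rule word_comb_words211_eq_0) simp
  \<comment> \<open>Entries 0, 6 and 8 of the list; \<open>2 * c = 0\<close> forces
    \<open>c = 0\<close> as 2 is invertible.\<close>
  then have "a + c = 0 \<and> 2 * c = 0 \<and> b + c = 0"
    by (simp only: list.set insert_subset singleton_iff)
  then show "set cs \<subseteq> {0}"
    using assms by (auto simp: cs)
next
  show "{lincomb cs ?fs |cs. length cs = length ?fs} = ?W"
  proof (intro set_eqI iffI)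
    fix f :: "(nat, 'a) falg"
    assume "f \<in> {lincomb cs ?fs |cs. length cs = length ?fs}"
    then obtain cs where cs: "length cs = length ?fs" and f: "f = lincomb cs ?fs"
      by blast
    from cs obtain a b c where "cs = [a, b, c]"
      by (auto simp: length_Suc_conv)
    then have "\<exists>ds. length ds = 12 \<and> f = word_comb words211 ds"
      unfolding f \<open>cs = _\<close> lincomb_char_ne_2 by (intro exI conjI, rule_tac [2] refl) simp
    moreover have "eval_nf p f = 0" for p
      unfolding f by (rule eval_nf_lincomb) (auto simp: eval_nf_times_St3 eval_nf_St3_times eval_nf_Phi211 simp del: One_nat_def)
    ultimately show "f \<in> ?W"
      unfolding identities_211_iff by blast
  next
    fix f :: "(nat, 'a) falg"
    assume "f \<in> ?W"
    then obtain cs where "length cs = 12" and f: "f = word_comb words211 cs" and *: "eval_nf p f = 0" for p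
      unfolding identities_211_iff by blast
    then obtain c0 c1 c2 c3 c4 c5 c6 c7 c8 c9 c10 c11
      where cs: "cs = [c0, c1, c2, c3, c4, c5, c6, c7, c8, c9, c10, c11]"
      by (elim length_12E)
    note rels = coeffs_of_identity[OF *[unfolded f cs]]
    \<comment> \<open>The scalar at \<open>Phi211\<close>: entries 0 and 1 of a combination are
      \<open>a + c\<close> and \<open>c - a\<close>, with sum \<open>2 * c\<close>. Then entries 0
      and 8 determine \<open>a = c0 - c\<close> and \<open>b = c8 - c\<close>.\<close>
    define c where "c = (c0 + c1) / 2"
    have eqs: "c1 = 2 * c - c0" "c6 = 2 * c"
      using rels(9) assms by (simp_all add: c_def field_simps)
    have "f = lincomb [c0 - c, c8 - c, c] ?fs"
      unfolding f cs lincomb_char_ne_2 rels(1-8) eqs by (simp add: algebra_simps del: word_comb_Cons)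
    moreover have "length [c0 - c, c8 - c, c] = length ?fs"
      by simp
    ultimately show "f \<in> {lincomb cs ?fs |cs. length cs = length ?fs}"
      by blast
  qed
qed

lemma basis_char_2:
  assumes "(2 :: 'a::field) = 0"
  shows "is_basis_of [X1 * St3 X1 X2 X3, St3 X1 X2 X3 * X1, Psi211,
      commutator (commutator X1 X2) (commutator X1 X3)]
    (identities_of_multidegree [2, 1, 1] (weyl_minus_1 :: 'a weyl set))" (is "is_basis_of ?fs ?W")
proof (rule is_basis_ofI)
  fix cs :: "'a list"
  assume "length cs = length ?fs" and *: "lincomb cs ?fs = 0"
  then obtain a b c d where cs: "cs = [a, b, c, d]"
    by (auto simp: length_Suc_conv)
  have "set [a + c, - a, d - a - c, a + b - d, a - d, d - a - b, - d, d - b, b, d, b + c - d, - b - c] \<subseteq> {0}"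
    using *[unfolded cs lincomb_char_2] by (rule word_comb_words211_eq_0) simp
  then have "a + c = 0 \<and> - a = 0 \<and> b = 0 \<and> d = 0"
    by (simp only: list.set insert_subset singleton_iff)
  then show "set cs \<subseteq> {0}"
    by (auto simp: cs)
next
  have uminus: "- x = x" for x :: 'a
    using assms by (metis add_eq_0_iff mult_2 mult_zero_left)
  show "{lincomb cs ?fs |cs. length cs = length ?fs} = ?W"
  proof (intro set_eqI iffI)
    fix f :: "(nat, 'a) falg"
    assume "f \<in> {lincomb cs ?fs |cs. length cs = length ?fs}"
    then obtain cs where cs: "length cs = length ?fs" and f: "f = lincomb cs ?fs"
      by blast
    from cs obtain a b c d where "cs = [a, b, c, d]"
      by (auto simp: length_Suc_conv)
    then have "\<exists>ds. length ds = 12 \<and> f = word_comb words211 ds"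
      unfolding f \<open>cs = _\<close> lincomb_char_2 by (intro exI conjI, rule_tac [2] refl) simp
    moreover have "eval_nf p f = 0" for p
      unfolding f using assms
      by (intro eval_nf_lincomb)
        (auto simp: eval_nf_times_St3 eval_nf_St3_times eval_nf_Psi211 eval_nf_commutator
          simp del: One_nat_def)
    ultimately show "f \<in> ?W"
      unfolding identities_211_iff by blast
  next
    fix f :: "(nat, 'a) falg"
    assume "f \<in> ?W"
    then obtain cs where "length cs = 12" and f: "f = word_comb words211 cs" and *: "eval_nf p f = 0" for p
      unfolding identities_211_iff by blast
    then obtain c0 c1 c2 c3 c4 c5 c6 c7 c8 c9 c10 c11
      where cs: "cs = [c0, c1, c2, c3, c4, c5, c6, c7, c8, c9, c10, c11]"
      by (elim length_12E)
    note rels = coeffs_of_identity[OF *[unfolded f cs]]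
    \<comment> \<open>Up to sign, entries 1, 8 and 6 of a combination are \<open>a\<close>,
      \<open>b\<close> and \<open>d\<close>; entry 0 is \<open>a + c\<close>, whence
      \<open>c = c0 - c1 = c0 + c1\<close>.\<close>
    have "f = lincomb [c1, c8, c0 + c1, c6] ?fs"
      unfolding f cs lincomb_char_2 rels(1-8)
      by (simp add: assms uminus diff_conv_add_uminus ac_simps del: word_comb_Cons add_uminus_conv_diff)
    moreover have "length [c1, c8, c0 + c1, c6] = length ?fs"
      by simp
    ultimately show "f \<in> {lincomb cs ?fs |cs. length cs = length ?fs}"
      by blast
  qed
qed

theorem proposition3p6:
  fixes p :: nat
  assumes "infinite (UNIV :: 'a::field set)"
    and "CHAR('a) = p"
  shows "(p \<noteq> 2 \<longrightarrow>
      is_basis_of [X1 * St3 X1 X2 X3, St3 X1 X2 X3 * X1, Phi211]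
        (identities_of_multidegree [2, 1, 1] (weyl_minus_1 :: 'a weyl set))) \<and>
    (p = 2 \<longrightarrow>
      is_basis_of [X1 * St3 X1 X2 X3, St3 X1 X2 X3 * X1, Psi211,
          commutator (commutator X1 X2) (commutator X1 X3)]
        (identities_of_multidegree [2, 1, 1] (weyl_minus_1 :: 'a weyl set)))"
proof -
  have "p = 2 \<longleftrightarrow> (2 :: 'a) = 0"
  proof
    assume "p = 2"
    then show "(2 :: 'a) = 0"
      using of_nat_CHAR[where 'a = 'a] assms(2) by simp
  next
    assume "(2 :: 'a) = 0"
    then have "p dvd 2"
      using of_nat_eq_0_iff_char_dvd[where 'a = 'a, of 2] assms(2) by simp
    \<comment> \<open>The divisors of 2 are 1 and 2, and a field does not have characteristic
      1.\<close>
    moreover have "p \<noteq> 1"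
      by (simp flip: assms(2))
    ultimately show "p = 2"
      using prime_nat_iff two_is_prime_nat by blast
  qed
  then show ?thesis
    using basis_char_ne_2[where 'a = 'a] basis_char_2[where 'a = 'a] by blast
qed

end
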